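(* Let $\lambda\in\mathbb{R}\setminus\{0\}$, let $r$ be a nonnegative integer and $p$ a nonnegative integer. Then for all real $x$, \begin{align*} &\sum_{n=1}^{\infty}\Big((1+r)_{p,\lambda}+(2+r)_{p,\lambda}+\cdots+(n+r)_{p,\lambda}\Big)\frac{x^{n}}{n!}\\ &=e^{x}\int_{0}^{x}\bigg(\big(\phi_{p+1,\lambda}^{(r)}(t)-(r)_{p+1,\lambda}\big)+(p\lambda-r)\big(\phi_{p,\lambda}^{(r)}(t)-(r)_{p,\lambda}\big)\bigg)\frac{dt}{t}. \end{align*}
   Context: For $\lambda\neq0$, $(x)_{0,\lambda}=1$ and $(x)_{n,\lambda}=x(x-\lambda)\cdots(x-(n-1)\lambda)$ for $n\ge1$; $e_{\lambda}^{x}(t)=(1+\lambda t)^{x/\lambda}$, $e_\lambda(t)=e_\lambda^1(t)$. The degenerate $r$-Bell polynomials are defined by $e_{\lambda}^{r}(t)e^{x(e_{\lambda}(t)-1)}=\sum_{n\ge0}\phi_{n,\lambda}^{(r)}(x)\frac{t^{n}}{n!}$. (Note $\phi^{(r)}_{n,\lambda}(0)=(r)_{n,\lambda}$, so the integrand is a polynomial in $t$.) *)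

theory Defs
  imports "HOL-Analysis.Analysis" "HOL-Computational_Algebra.Formal_Power_Series"
begin

definition degenerate_ffact :: "real \<Rightarrow> real \<Rightarrow> nat \<Rightarrow> real" where
  "degenerate_ffact lam x n = (\<Prod>i<n. x - real i * lam)"

(* Generating functions are read as formal power series in t.  Since "fps_binomial c" is
   the binomial series (1 + t)^c, this is e_lam^x(t) = (1 + lam t)^(x/lam). *)
definition degenerate_exp :: "real \<Rightarrow> real \<Rightarrow> real fps" where
  "degenerate_exp lam x = fps_binomial (x / lam) oo (fps_const lam * fps_X)"

(* The series degenerate_exp lam 1 - 1 has constant coefficient 0, so the composition
   is the genuine substitution into exp.  The factor "fact n" comes from t^n / n! in
   e_lam^r(t) * exp (x * (e_lam(t) - 1)) = (SUM n. phi_n(x) * t^n / n!). *)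
definition degenerate_r_bell :: "real \<Rightarrow> nat \<Rightarrow> nat \<Rightarrow> real \<Rightarrow> real" where
  "degenerate_r_bell lam r n x =
     fact n * fps_nth (degenerate_exp lam (real r) *
       (fps_exp 1 oo (fps_const x * (degenerate_exp lam 1 - 1)))) n"

end

theory Submission
  imports Defs
begin

text \<open>
  Write \<open>E = degenerate_exp lam 1\<close>. Expanding \<open>E ^ k = (1 + (E - 1)) ^ k\<close> gives
  \<open>(k + r)\<^sub>n = (\<Sum>j\<le>n. c\<^sub>j * (k choose j))\<close>, where \<open>c\<^sub>j\<close> is \<open>n!\<close> times the \<open>n\<close>-th coefficient of
  \<open>E ^ r * (E - 1) ^ j\<close>, and the \<open>r\<close>-Bell polynomial is \<open>\<Sum>j\<le>n. c\<^sub>j * t ^ j / j!\<close>.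
  Since \<open>\<Sum>k. (k choose j) * t ^ k / k! = exp t * t ^ j / j!\<close>, a Dobinski formula follows. It shows
  that the integrand is the \<open>(r + 1)\<close>-Bell polynomial of index \<open>p\<close>. Summing binomial coefficients
  over \<open>k < n\<close> raises \<open>j\<close> to \<open>j + 1\<close>, which is what integrating \<open>t ^ j / j!\<close> does as well.
\<close>

lemma degenerate_exp_nth:
  assumes "lam \<noteq> 0"
  shows "fps_nth (degenerate_exp lam x) n = degenerate_ffact lam x n / fact n"
proof -
  \<comment> \<open>Pulling \<open>lam\<close> out of every factor leaves the product that defines
    \<open>fact n * ((x / lam) gchoose n)\<close>.\<close>
  have "(\<Prod>i<n. x - real i * lam) = (\<Prod>i<n. lam * (x / lam - real i))"
    using assms by (intro prod.cong) (auto simp: field_simps)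
  then have "degenerate_ffact lam x n = lam ^ n * (\<Prod>i = 0..<n. x / lam - real i)"
    by (simp add: degenerate_ffact_def prod.distrib lessThan_atLeast0)
  then show ?thesis
    by (simp add: degenerate_exp_def fps_compose_linear gbinomial_prod_rev)
qed

lemma degenerate_exp_add:
  "degenerate_exp lam (x + y) = degenerate_exp lam x * degenerate_exp lam y"
  unfolding degenerate_exp_def
  by (simp add: add_divide_distrib fps_binomial_add_mult fps_compose_mult_distrib)

lemma degenerate_exp_0: "degenerate_exp lam 0 = 1"
  by (simp add: degenerate_exp_def fps_binomial_0)

lemma degenerate_exp_of_nat: "degenerate_exp lam (real k) = degenerate_exp lam 1 ^ k"
  by (induction k) (simp_all add: degenerate_exp_0 degenerate_exp_add)

lemma degenerate_exp_minus_1_nth_0: "fps_nth (degenerate_exp lam 1 - 1) 0 = 0"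
  by (simp add: degenerate_exp_def)

lemma degenerate_ffact_Suc:
  "degenerate_ffact lam x (Suc n) = (x - real n * lam) * degenerate_ffact lam x n"
  by (simp add: degenerate_ffact_def)

text \<open>These are \<open>fact j\<close> times the degenerate \<open>r\<close>-Stirling numbers
  of the second kind; with that factor they pair directly with \<open>k choose j\<close> and
  \<open>x ^ j / fact j\<close>.\<close>

definition bell_coeff :: "real \<Rightarrow> nat \<Rightarrow> nat \<Rightarrow> nat \<Rightarrow> real" where
  "bell_coeff lam r n j =
     fact n * fps_nth (degenerate_exp lam (real r) * (degenerate_exp lam 1 - 1) ^ j) n"

lemma fps_mult_power_nth_eq_0:
  fixes A B :: "'a::comm_ring_1 fps"
  assumes "fps_nth A 0 = 0" "n < j"
  shows "fps_nth (B * A ^ j) n = 0"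
  unfolding fps_mult_nth
  using assms by (intro sum.neutral) (auto simp: startsby_zero_power_prefix)

lemma bell_coeff_eq_0: "n < j \<Longrightarrow> bell_coeff lam r n j = 0"
  unfolding bell_coeff_def
  by (simp only: fps_mult_power_nth_eq_0[OF degenerate_exp_minus_1_nth_0] mult_zero_right)

lemma fps_mult_compose_nth:
  fixes A B F :: "'a::comm_ring_1 fps"
  assumes "fps_nth A 0 = 0"
  shows "fps_nth (B * (F oo A)) n = (\<Sum>j\<le>n. fps_nth F j * fps_nth (B * A ^ j) n)"
proof -
  \<comment> \<open>Since \<open>A ^ j\<close> has no terms below degree \<open>j\<close>, the range
    can be extended to \<open>j \<le> n\<close>, independent of \<open>i\<close>, so that the two
    sums can be swapped.\<close>
  have "fps_nth (F oo A) (n - i) = (\<Sum>j\<le>n. fps_nth F j * fps_nth (A ^ j) (n - i))" for i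
    unfolding fps_compose_nth
    using assms by (intro sum.mono_neutral_left) (auto simp: startsby_zero_power_prefix)
  then have "fps_nth (B * (F oo A)) n
      = (\<Sum>i=0..n. \<Sum>j\<le>n. fps_nth F j * (fps_nth B i * fps_nth (A ^ j) (n - i)))"
    by (simp add: fps_mult_nth sum_distrib_left mult.left_commute)
  also have "\<dots> = (\<Sum>j\<le>n. fps_nth F j * fps_nth (B * A ^ j) n)"
    by (subst sum.swap) (simp add: fps_mult_nth sum_distrib_left)
  finally show ?thesis .
qed

lemma degenerate_r_bell_eq_sum:
  "degenerate_r_bell lam r n x = (\<Sum>j\<le>n. bell_coeff lam r n j * (x ^ j / fact j))"
proof -
  let ?E = "degenerate_exp lam 1 - 1" and ?R = "degenerate_exp lam (real r)"
  have "fps_nth (fps_const x * ?E) 0 = 0"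
    by (simp only: fps_mult_nth_0 degenerate_exp_minus_1_nth_0 mult_zero_right)
  moreover have "?R * (fps_const x * ?E) ^ j = fps_const (x ^ j) * (?R * ?E ^ j)" for j
    by (simp only: power_mult_distrib fps_const_power mult.left_commute)
  ultimately show ?thesis
    unfolding degenerate_r_bell_def bell_coeff_def
    by (simp only: fps_mult_compose_nth fps_mult_left_const_nth fps_exp_nth)
      (simp add: sum_distrib_left mult_ac)
qed

lemma degenerate_ffact_eq_sum_binomial:
  assumes "lam \<noteq> 0"
  shows "degenerate_ffact lam (real (k + r)) n = (\<Sum>j\<le>n. bell_coeff lam r n j * real (k choose j))"
proof -
  let ?E = "degenerate_exp lam 1 - 1" and ?R = "degenerate_exp lam (real r)"
  have "degenerate_exp lam (real (k + r)) = ?R * (?E + 1) ^ k"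
    by (simp add: degenerate_exp_add degenerate_exp_of_nat mult.commute)
  also have "\<dots> = (\<Sum>j\<le>k. of_nat (k choose j) * (?R * ?E ^ j))"
    by (subst binomial_ring) (simp add: sum_distrib_left mult_ac)
  finally have "degenerate_ffact lam (real (k + r)) n
      = (\<Sum>j\<le>k. fact n * fps_nth (of_nat (k choose j) * (?R * ?E ^ j)) n)"
    using degenerate_exp_nth[OF assms, of "real (k + r)" n]
    by (simp add: fps_sum_nth sum_distrib_left field_simps)
  also have "\<dots> = (\<Sum>j\<le>k. bell_coeff lam r n j * real (k choose j))"
    unfolding bell_coeff_def
    by (simp only: fps_of_nat[symmetric] fps_mult_left_const_nth) (simp add: mult_ac)
  \<comment> \<open>Terms with \<open>j > k\<close> vanish through the binomial, those with
    \<open>j > n\<close> through \<open>bell_coeff\<close>.\<close>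
  also have "\<dots> = (\<Sum>j\<le>max k n. bell_coeff lam r n j * real (k choose j))"
    by (intro sum.mono_neutral_left) auto
  also have "\<dots> = (\<Sum>j\<le>n. bell_coeff lam r n j * real (k choose j))"
    by (intro sum.mono_neutral_right) (auto simp: bell_coeff_eq_0)
  finally show ?thesis .
qed

text \<open>The exponential series times \<open>x ^ j / fact j\<close>, re-indexed by
  \<open>j\<close>; the first \<open>j\<close> terms are zero because \<open>k choose j\<close>
  is.\<close>

lemma sums_binomial_exp:
  fixes x :: real
  shows "(\<lambda>k. real (k choose j) * x ^ k / fact k) sums (exp x * (x ^ j / fact j))"
proof -
  have "(\<lambda>k. x ^ k / fact k * (x ^ j / fact j)) sums (exp x * (x ^ j / fact j))"
    using exp_converges[of x] by (intro sums_mult2) (simp add: field_simps)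
  moreover have "x ^ k / fact k * (x ^ j / fact j)
      = real (k + j choose j) * x ^ (k + j) / fact (k + j)" for k
    by (simp add: binomial_fact power_add)
  ultimately have
    "(\<lambda>k. real (k + j choose j) * x ^ (k + j) / fact (k + j)) sums (exp x * (x ^ j / fact j))"
    by simp
  then show ?thesis
    by (subst sums_zero_iff_shift[of j, symmetric]) simp_all
qed

text \<open>The index map \<open>h\<close> serves two uses: the identity for the Dobinski formula,
  \<open>Suc\<close> for the partial sums.\<close>

lemma sums_binomial_sum_exp:
  fixes x :: real and c :: "nat \<Rightarrow> real"
  assumes "\<And>k. a k = (\<Sum>j\<le>n. c j * real (k choose h j))"
  shows "(\<lambda>k. a k * x ^ k / fact k) sums (exp x * (\<Sum>j\<le>n. c j * (x ^ h j / fact (h j))))"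
proof -
  have "(\<lambda>k. \<Sum>j\<le>n. c j * (real (k choose h j) * x ^ k / fact k))
      sums (\<Sum>j\<le>n. c j * (exp x * (x ^ h j / fact (h j))))"
    by (intro sums_sum sums_mult sums_binomial_exp)
  then show ?thesis
    by (simp add: assms sum_distrib_left sum_distrib_right sum_divide_distrib mult_ac)
qed

lemma dobinski_degenerate_r_bell:
  assumes "lam \<noteq> 0"
  shows "(\<lambda>k. degenerate_ffact lam (real (k + r)) n * x ^ k / fact k)
    sums (exp x * degenerate_r_bell lam r n x)"
  unfolding degenerate_r_bell_eq_sum
  by (rule sums_binomial_sum_exp[where h = "\<lambda>j. j"]) (rule degenerate_ffact_eq_sum_binomial[OF assms])

text \<open>Compare Dobinski series: \<open>(k + r - p * lam) + (p * lam - r) = k\<close>, and the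
  weight \<open>k\<close> turns \<open>x ^ k / fact k\<close> into \<open>x\<close> times the
  preceding term, where \<open>Suc k + r = k + Suc r\<close>.\<close>

lemma degenerate_r_bell_Suc_index:
  assumes "lam \<noteq> 0"
  shows "degenerate_r_bell lam r (Suc p) x + (real p * lam - real r) * degenerate_r_bell lam r p x
    = x * degenerate_r_bell lam (Suc r) p x"
proof -
  let ?a = "\<lambda>n k. degenerate_ffact lam (real (k + r)) n * x ^ k / fact k"
  let ?b = "\<lambda>k. real k * ?a p k"
  have "(\<lambda>k. ?a (Suc p) k + (real p * lam - real r) * ?a p k)
      sums (exp x * degenerate_r_bell lam r (Suc p) x
        + (real p * lam - real r) * (exp x * degenerate_r_bell lam r p x))"
    by (intro sums_add sums_mult dobinski_degenerate_r_bell assms)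
  moreover have "?a (Suc p) k + (real p * lam - real r) * ?a p k = ?b k" for k
    unfolding degenerate_ffact_Suc by (simp add: field_simps)
  ultimately have l: "?b sums (exp x * degenerate_r_bell lam r (Suc p) x
        + (real p * lam - real r) * (exp x * degenerate_r_bell lam r p x))"
    by simp
  have "?b (Suc k)
      = x * (degenerate_ffact lam (real (k + Suc r)) p * x ^ k / fact k)" for k
    by (simp add: divide_simps del: of_nat_Suc of_nat_add)
  then have "(\<lambda>k. ?b (Suc k)) sums (x * (exp x * degenerate_r_bell lam (Suc r) p x))"
    using sums_mult[OF dobinski_degenerate_r_bell[OF assms, of "Suc r" p x], of x]
    by (simp add: mult.left_commute)
  \<comment> \<open>The weight \<open>real k\<close> kills the term at 0, so the shift loses
    nothing.\<close>
  then have "?b sums (x * (exp x * degenerate_r_bell lam (Suc r) p x))"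
    using sums_Suc_iff[of ?b] by simp
  from sums_unique2[OF l this] have
    "exp x * (degenerate_r_bell lam r (Suc p) x + (real p * lam - real r) * degenerate_r_bell lam r p x)
      = exp x * (x * degenerate_r_bell lam (Suc r) p x)"
    by (simp add: algebra_simps)
  then show ?thesis by simp
qed

text \<open>Reading \<open>Suc n + r\<close> as \<open>n + Suc r\<close> expands the new summand in
  \<open>n choose j\<close>, which Pascal's rule merges with \<open>n choose Suc j\<close>.\<close>

lemma sum_degenerate_ffact_eq_sum_binomial:
  assumes "lam \<noteq> 0"
  shows "(\<Sum>k=1..n. degenerate_ffact lam (real k + real r) p)
    = (\<Sum>j\<le>p. bell_coeff lam (Suc r) p j * real (n choose Suc j))"
proof (induction n)
  case (Suc n)
  have "degenerate_ffact lam (real (Suc n) + real r) p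
      = (\<Sum>j\<le>p. bell_coeff lam (Suc r) p j * real (n choose j))"
    using degenerate_ffact_eq_sum_binomial[OF assms, of n "Suc r" p] by (simp add: add_ac)
  with Suc show ?case
    by (simp add: sum.distrib[symmetric] algebra_simps)
qed simp

lemma has_vector_derivative_power_over_fact:
  fixes t :: real
  shows "((\<lambda>t. t ^ Suc j / fact (Suc j)) has_vector_derivative t ^ j / fact j) (at t within S)"
  unfolding has_real_derivative_iff_has_vector_derivative[symmetric]
  by (rule derivative_eq_intros refl | simp add: divide_simps)+

lemma interval_integral_degenerate_r_bell:
  "(LBINT t=0..ereal x. degenerate_r_bell lam r n t)
    = (\<Sum>j\<le>n. bell_coeff lam r n j * (x ^ Suc j / fact (Suc j)))"
proof -
  let ?F = "\<lambda>t. \<Sum>j\<le>n. bell_coeff lam r n j * (t ^ Suc j / fact (Suc j))"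
  have "(LBINT t=ereal 0..ereal x. degenerate_r_bell lam r n t) = ?F x - ?F 0"
    unfolding degenerate_r_bell_eq_sum
    by (rule interval_integral_FTC_finite)
      (intro continuous_intros has_vector_derivative_sum has_vector_derivative_mult_right
        has_vector_derivative_power_over_fact | simp)+
  then show ?thesis by (simp add: zero_ereal_def)
qed

text \<open>The use of \<open>min\<close> and \<open>max\<close> covers both orientations, as the
  upper limit \<open>x\<close> may be negative.\<close>

lemma interval_integrable_cong:
  assumes "\<And>x. x \<in> einterval (min a b) (max a b) \<Longrightarrow> f x = g x"
  shows "interval_lebesgue_integrable M a b f = interval_lebesgue_integrable M a b g"
  using assms set_integrable_cong[of M M "einterval a b" "einterval a b" f g]
    set_integrable_cong[of M M "einterval b a" "einterval b a" f g]
  unfolding interval_lebesgue_integrable_def by (cases "a \<le> b") simp_all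

theorem theorem5:
  fixes lam x :: real and r p :: nat
  assumes "lam \<noteq> 0"
  shows "let f = (\<lambda>t. ((degenerate_r_bell lam r (p + 1) t - degenerate_ffact lam (real r) (p + 1))
        + (real p * lam - real r) * (degenerate_r_bell lam r p t - degenerate_ffact lam (real r) p)) / t)
    in interval_lebesgue_integrable lborel 0 (ereal x) f \<and>
       (\<lambda>n. (\<Sum>k=1..Suc n. degenerate_ffact lam (real k + real r) p) * x ^ Suc n / fact (Suc n))
         sums (exp x * (LBINT t=0..ereal x. f t))"
proof -
  define f where "f = (\<lambda>t. ((degenerate_r_bell lam r (p + 1) t - degenerate_ffact lam (real r) (p + 1))
        + (real p * lam - real r) * (degenerate_r_bell lam r p t - degenerate_ffact lam (real r) p)) / t)"
  let ?g = "degenerate_r_bell lam (Suc r) p"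
  \<comment> \<open>The subtracted constants cancel: \<open>degenerate_ffact_Suc\<close> at
    \<open>real r\<close> gives the factor \<open>r - p * lam\<close>, the negative of
    \<open>p * lam - r\<close>.\<close>
  have f_eq: "f t = ?g t" if "t \<noteq> 0" for t
    using that degenerate_r_bell_Suc_index[OF assms, of r p t]
    by (simp add: f_def degenerate_ffact_Suc divide_simps) (simp add: algebra_simps)
  \<comment> \<open>The junk value \<open>f 0 = 0\<close> is harmless, as the interval of integration is open.\<close>
  have f_eq': "f t = ?g t" if "t \<in> einterval (min 0 (ereal x)) (max 0 (ereal x))" for t
    using that by (intro f_eq) (auto simp: einterval_def min_def max_def split: if_splits)
  have "interval_lebesgue_integrable lborel (ereal 0) (ereal x) ?g"
    unfolding degenerate_r_bell_eq_sum
    by (intro interval_integrable_isCont continuous_intros) simp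
  then have "interval_lebesgue_integrable lborel 0 (ereal x) f"
    using interval_integrable_cong[of 0 "ereal x" f ?g lborel, OF f_eq']
    by (simp only: zero_ereal_def)
  moreover have "(LBINT t=0..ereal x. f t)
      = (\<Sum>j\<le>p. bell_coeff lam (Suc r) p j * (x ^ Suc j / fact (Suc j)))"
    unfolding interval_integral_degenerate_r_bell[symmetric]
    by (rule interval_integral_cong) (rule f_eq')
  moreover have "(\<lambda>n. (\<Sum>k=1..n. degenerate_ffact lam (real k + real r) p) * x ^ n / fact n)
      sums (exp x * (\<Sum>j\<le>p. bell_coeff lam (Suc r) p j * (x ^ Suc j / fact (Suc j))))"
    by (rule sums_binomial_sum_exp) (rule sum_degenerate_ffact_eq_sum_binomial[OF assms])
  \<comment> \<open>The claimed series starts at index 1; the term at index 0 is an empty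
    sum.\<close>
  ultimately show ?thesis
    unfolding Let_def f_def[symmetric] by (subst sums_Suc_iff) simp
qed

end
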